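(* Let $A$ be an $m\times m$ nonsingular real matrix, $K=A\mathbb{R}^m_+$ the corresponding simplicial cone and $z\in\mathbb{R}^m$ arbitrary. Then the equation $$\left(A^\top A-I\right)x^++x=A^\top z$$ has a unique solution $u\in\mathbb{R}^m$, and $P_K(z)=Au^+$.
   Context: $\mathbb{R}^m$ carries the canonical scalar product and the Euclidean norm $\|\cdot\|$. $I$ is the $m\times m$ identity matrix. For $x=(x^1,\dots,x^m)\in\mathbb{R}^m$, $x^+=(\max\{x^1,0\},\dots,\max\{x^m,0\})$. $\mathbb{R}^m_+$ is the nonnegative orthant, $A\mathbb{R}^m_+=\{Ay:y\in\mathbb{R}^m_+\}$, and $P_K(z)=\operatorname{argmin}\{\|z-y\|:y\in K\}$ is the metric projection of $z$ onto $K$. *)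

theory Defs
  imports "HOL-Analysis.Analysis"
begin

text \<open>The metric projection onto \<open>K\<close> is the library's \<^const>\<open>closest_point\<close>; it is a choice of
  a minimiser, which exists and is unique when \<open>K\<close> is nonempty, closed and convex.\<close>

definition pos_part :: "real ^ 'm \<Rightarrow> real ^ 'm"
  where "pos_part x = (\<chi> i. max (x $ i) 0)"

definition nonneg_orthant :: "(real ^ 'm) set"
  where "nonneg_orthant = {y. \<forall>i. 0 \<le> y $ i}"

definition simplicial_cone :: "real ^ 'm ^ 'm \<Rightarrow> (real ^ 'm) set"
  where "simplicial_cone A = (*v) A ` nonneg_orthant"

end

theory Submission
  imports Defs
begin

text \<open>Writing \<open>v = pos_part u\<close>, the equation says \<open>A\<^sup>T (z - A v) = u - v\<close>. The pairs \<open>(u, v)\<close>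
  with \<open>v = pos_part u\<close> are exactly those satisfying the variational inequality
  \<open>(u - v) \<bullet> (y - v) \<le> 0\<close> for all \<open>y\<close> in the orthant, and moving \<open>A\<^sup>T\<close> across the inner product
  turns it into the variational inequality that characterises \<open>A v\<close> as the projection of \<open>z\<close>.\<close>

text \<open>For the converse, expand the squared distance from \<open>a\<close> to \<open>y\<close>
  around \<open>x\<close>: the inequality gives the cross term the favourable sign.\<close>

lemma closest_point_eq_iff_dot:
  fixes S :: "'a::euclidean_space set"
  assumes "convex S" "closed S" "x \<in> S"
  shows "closest_point S a = x \<longleftrightarrow> (\<forall>y\<in>S. (a - x) \<bullet> (y - x) \<le> 0)"
proof
  assume "closest_point S a = x"
  then show "\<forall>y\<in>S. (a - x) \<bullet> (y - x) \<le> 0"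
    using closest_point_dot[OF assms(1,2)] by blast
next
  assume ineq: "\<forall>y\<in>S. (a - x) \<bullet> (y - x) \<le> 0"
  have "dist a x \<le> dist a y" if "y \<in> S" for y
  proof -
    have "(a - y) \<bullet> (a - y) =
        (a - x) \<bullet> (a - x) - 2 * ((a - x) \<bullet> (y - x)) + (y - x) \<bullet> (y - x)"
      by (simp add: inner_diff inner_commute)
    moreover have "(a - x) \<bullet> (y - x) \<le> 0"
      using ineq that by blast
    ultimately show ?thesis
      using inner_ge_zero[of "y - x"] unfolding dist_norm norm_le by linarith
  qed
  then show "closest_point S a = x"
    using closest_point_unique[OF assms] by blast
qed

lemma pos_part_in_nonneg_orthant: "pos_part u \<in> nonneg_orthant"
  by (simp add: pos_part_def nonneg_orthant_def)

lemma convex_nonneg_orthant: "convex nonneg_orthant"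
  by (auto simp: convex_def nonneg_orthant_def)

lemma closed_nonneg_orthant: "closed nonneg_orthant"
  unfolding nonneg_orthant_def by (intro closed_Collect_all closed_Collect_le continuous_intros)

text \<open>This makes \<open>pos_part\<close> the projection onto the orthant. The orthant is a
  product of half-lines, so the inequality decouples into coordinates.\<close>

lemma pos_part_eq_iff_dot:
  assumes "v \<in> nonneg_orthant"
  shows "pos_part u = v \<longleftrightarrow> (\<forall>y\<in>nonneg_orthant. (u - v) \<bullet> (y - v) \<le> 0)"
proof
  assume v: "pos_part u = v"
  have "(u $ i - v $ i) * (y $ i - v $ i) \<le> 0" if "y \<in> nonneg_orthant" for y i
    using that unfolding v[symmetric]
    by (auto simp: pos_part_def nonneg_orthant_def max_def mult_nonpos_nonneg)
  then show "\<forall>y\<in>nonneg_orthant. (u - v) \<bullet> (y - v) \<le> 0"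
    by (auto simp: inner_vec_def intro!: sum_nonpos)
next
  assume ineq: "\<forall>y\<in>nonneg_orthant. (u - v) \<bullet> (y - v) \<le> 0"
  \<comment> \<open>Moving \<open>v\<close> along a single axis while staying in the orthant
    isolates coordinate \<open>i\<close>.\<close>
  have coord: "(u $ i - v $ i) * t \<le> 0" if "0 \<le> v $ i + t" for i t
  proof -
    have "v + axis i t \<in> nonneg_orthant"
      using assms that by (auto simp: nonneg_orthant_def axis_def)
    with ineq have "(u - v) \<bullet> axis i t \<le> 0"
      by force
    then show ?thesis
      by (simp add: inner_axis)
  qed
  have "max (u $ i) 0 = v $ i" for i
  proof -
    have "0 \<le> v $ i"
      using assms by (simp add: nonneg_orthant_def)
    moreover from this have "u $ i \<le> v $ i"
      using coord[of i 1] by simp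
    \<comment> \<open>The step \<open>t = - (v $ i)\<close> sends the coordinate to 0 and yields
      complementarity: \<open>v $ i * (u $ i - v $ i)\<close> is nonnegative.\<close>
    moreover have "v $ i = 0 \<or> v $ i \<le> u $ i"
      using coord[of i "- (v $ i)"] \<open>0 \<le> v $ i\<close> by (auto simp: zero_le_mult_iff)
    ultimately show ?thesis
      by (auto simp: max_def)
  qed
  then show "pos_part u = v"
    by (simp add: pos_part_def vec_eq_iff)
qed

lemma convex_simplicial_cone: "convex (simplicial_cone A)"
  unfolding simplicial_cone_def
  by (intro convex_linear_image convex_nonneg_orthant) auto

lemma closed_simplicial_cone:
  assumes "invertible A"
  shows "closed (simplicial_cone A)"
  unfolding simplicial_cone_def
  using assms closed_nonneg_orthant
  by (intro closed_injective_linear_image) (auto simp: inj_matrix_vector_mult)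

lemma matrix_vector_mult_in_simplicial_cone:
  assumes "v \<in> nonneg_orthant"
  shows "A *v v \<in> simplicial_cone A"
  using assms by (simp add: simplicial_cone_def)

text \<open>Points of the cone are the \<open>A *v y\<close> with \<open>y\<close> in the orthant,
  so the adjoint identity matches the two variational inequalities for each
  \<open>y\<close>.\<close>

lemma closest_point_simplicial_cone_iff:
  assumes "invertible A" "v \<in> nonneg_orthant"
  shows "closest_point (simplicial_cone A) z = A *v v \<longleftrightarrow>
    pos_part (v + transpose A *v (z - A *v v)) = v"
proof -
  have "(z - A *v v) \<bullet> (A *v y - A *v v) = (transpose A *v (z - A *v v)) \<bullet> (y - v)" for y
    by (metis dot_lmul_matrix matrix_vector_mult_diff_distrib transpose_matrix_vector)
  then show ?thesis
    unfolding pos_part_eq_iff_dot[OF assms(2)]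
      closest_point_eq_iff_dot[OF convex_simplicial_cone closed_simplicial_cone[OF assms(1)]
        matrix_vector_mult_in_simplicial_cone[OF assms(2)]]
    by (simp add: simplicial_cone_def)
qed

theorem lemma4:
  fixes A :: "real ^ 'm ^ 'm" and z :: "real ^ 'm"
  assumes "invertible A"
  shows "(\<exists>!u. (transpose A ** A - mat 1) *v pos_part u + u = transpose A *v z) \<and>
    (\<forall>u. (transpose A ** A - mat 1) *v pos_part u + u = transpose A *v z \<longrightarrow>
      closest_point (simplicial_cone A) z = A *v pos_part u)"
proof -
  let ?P = "closest_point (simplicial_cone A) z"
  define eqn where "eqn u \<longleftrightarrow>
    (transpose A ** A - mat 1) *v pos_part u + u = transpose A *v z" for u
  have eqn_iff: "eqn u \<longleftrightarrow> u = pos_part u + transpose A *v (z - A *v pos_part u)" for u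
    unfolding eqn_def
    by (auto simp: matrix_vector_mult_diff_rdistrib matrix_vector_mult_diff_distrib
        matrix_vector_mul_assoc algebra_simps)
  \<comment> \<open>With \<open>v = pos_part u\<close>, the fixed-point form of \<open>eqn\<close>
    collapses the right side of the equivalence to \<open>pos_part u = pos_part u\<close>.\<close>
  have proj: "?P = A *v pos_part u" if "eqn u" for u
    using that closest_point_simplicial_cone_iff[OF assms pos_part_in_nonneg_orthant] eqn_iff
    by metis
  have "\<exists>u. eqn u"
  proof -
    have "?P \<in> simplicial_cone A"
      using closed_simplicial_cone[OF assms]
        matrix_vector_mult_in_simplicial_cone[OF pos_part_in_nonneg_orthant]
      by (intro closest_point_in_set) auto
    then obtain v where "v \<in> nonneg_orthant" "?P = A *v v"
      by (auto simp: simplicial_cone_def)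
    \<comment> \<open>Since \<open>A *v v\<close> is the projection, the positive part of this
      witness is \<open>v\<close> itself, which closes the fixed-point equation.\<close>
    then have "eqn (v + transpose A *v (z - A *v v))"
      using closest_point_simplicial_cone_iff[OF assms] eqn_iff by metis
    then show ?thesis ..
  qed
  moreover have "u = u'" if "eqn u" "eqn u'" for u u'
  proof -
    \<comment> \<open>Both sides are the one projection \<open>?P\<close>. Injectivity of
      \<open>A\<close> then identifies the positive parts, and \<open>eqn_iff\<close> recovers a
      solution from its positive part.\<close>
    have "A *v pos_part u = A *v pos_part u'"
      using proj that by metis
    then have "pos_part u = pos_part u'"
      using inj_matrix_vector_mult[OF assms] by (simp add: inj_eq)
    then show ?thesis
      using that eqn_iff by metis
  qed
  ultimately show ?thesis
    using proj unfolding eqn_def by blast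
qed

end
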